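(* Let $\sigma$ be a nonempty compact subset of $\mathbb{C}$. Then for every $f\in\mathrm{Lip}(\sigma)$, $$\|f\|_{BV(\sigma)}\le\max\{1,C_\sigma\}\,\|f\|_{\mathrm{Lip}(\sigma)},$$ and so $\mathrm{Lip}(\sigma)\subseteq BV(\sigma)$.
   Context: Identify $\mathbb{C}$ with $\mathbb{R}^2$. A list $S=[x_0,x_1,\dots,x_n]$ ($n\ge 0$) is a finite ordered list of points of the plane; repetitions are allowed. For a line $\ell$ in the plane and $n\ge 1$, the segment $\overline{x_j\,x_{j+1}}$ ($0\le j<n$) is a crossing segment of $S$ on $\ell$ if one of the following holds: (1) $x_j$ and $x_{j+1}$ lie on strictly opposite sides of $\ell$; (2) $j=0$ and $x_0\in\ell$; (3) $x_j\notin\ell$ and $x_{j+1}\in\ell$. Let $\mathrm{vf}(S,\ell)$ be the number of crossing segments of $S$ on $\ell$ (counted by index $j$); for $n=0$ put $\mathrm{vf}([x_0],\ell)=1$ if $x_0\in\ell$ and $0$ otherwise. The variation factor is $\mathrm{vf}(S)=\max_\ell \mathrm{vf}(S,\ell)$, the maximum over all lines in the plane. For a nonempty compact set $\sigma$ in the plane, $f:\sigma\to\mathbb{C}$ and a list $S=[x_0,\dots,x_n]$ of elements of $\sigma$, put $\mathrm{cvar}(f,S)=\sum_{i=1}^n|f(x_i)-f(x_{i-1})|$ (equal to $0$ if $n=0$), and $\mathrm{var}(f,\sigma)=\sup_S \mathrm{cvar}(f,S)/\mathrm{vf}(S)\in[0,\infty]$, the supremum over all finite ordered lists of elements of $\sigma$.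 Put $\|f\|_{BV(\sigma)}=\|f\|_\infty+\mathrm{var}(f,\sigma)$ with $\|f\|_\infty=\sup_{z\in\sigma}|f(z)|$, and $BV(\sigma)=\{f:\sigma\to\mathbb{C} : \|f\|_{BV(\sigma)}<\infty\}$. The variation constant of $\sigma$ is $C_\sigma=\mathrm{var}(\zeta,\sigma)$, where $\zeta:\sigma\to\mathbb{C}$, $\zeta(z)=z$; it is finite. $\mathrm{Lip}(\sigma)$ is the space of functions $f:\sigma\to\mathbb{C}$ for which $\|f\|_{\mathrm{Lip}(\sigma)}=\|f\|_\infty+L_\sigma(f)$ is finite, where $L_\sigma(f)=\sup\{|f(x)-f(x')|/|x-x'| : x\ne x'\in\sigma\}$ (and $L_\sigma(f)=0$ if $\sigma$ is a singleton). *)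

theory Defs
  imports "HOL-Analysis.Analysis"
begin

definition plane_line :: "complex set \<Rightarrow> bool" where
  "plane_line l \<longleftrightarrow> affine l \<and> aff_dim l = 1"

text \<open>The two sides of a line are the open half-planes determined by any of its equations; the
  condition is symmetric in the two points because \<open>a\<close> and \<open>b\<close> may be negated.\<close>

definition opposite_sides :: "complex set \<Rightarrow> complex \<Rightarrow> complex \<Rightarrow> bool" where
  "opposite_sides l x y \<longleftrightarrow>
     (\<exists>a b. a \<noteq> 0 \<and> l = {z. a \<bullet> z = b} \<and> a \<bullet> x < b \<and> b < a \<bullet> y)"

text \<open>The list \<open>[x\<^sub>0, \<dots>, x\<^sub>n]\<close> has length \<open>n + 1\<close>; the empty list is not a list in the sense of
  this theory and is excluded where lists are quantified over.\<close>

definition crossing_segment :: "complex list \<Rightarrow> complex set \<Rightarrow> nat \<Rightarrow> bool" where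
  "crossing_segment S l j \<longleftrightarrow>
     opposite_sides l (S ! j) (S ! Suc j) \<or>
     (j = 0 \<and> S ! 0 \<in> l) \<or>
     (S ! j \<notin> l \<and> S ! Suc j \<in> l)"

definition vf_on :: "complex list \<Rightarrow> complex set \<Rightarrow> nat" where
  "vf_on S l =
     (if length S = 1 then (if S ! 0 \<in> l then 1 else 0)
      else card {j. Suc j < length S \<and> crossing_segment S l j})"

text \<open>The set of values is finite, as \<open>vf_on S l \<le> length S\<close>, so the maximum exists. It is at least
  1 for nonempty \<open>S\<close> (take a line through the first point), so the quotients in \<open>var\<close> below never
  divide by zero.\<close>

definition vf :: "complex list \<Rightarrow> nat" where
  "vf S = Max {vf_on S l | l. plane_line l}"

definition cvar :: "(complex \<Rightarrow> complex) \<Rightarrow> complex list \<Rightarrow> real" where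
  "cvar f S = (\<Sum>i = 1..<length S. norm (f (S ! i) - f (S ! (i - 1))))"

text \<open>Functions on \<open>\<sigma>\<close> are represented by total functions, of which only the values on \<open>\<sigma>\<close> matter.
  Norms take values in \<^typ>\<open>ennreal\<close>, where the supremum of the empty set is 0.\<close>

definition var :: "(complex \<Rightarrow> complex) \<Rightarrow> complex set \<Rightarrow> ennreal" where
  "var f \<sigma> = (SUP S \<in> {S. S \<noteq> [] \<and> set S \<subseteq> \<sigma>}. ennreal (cvar f S / real (vf S)))"

definition sup_norm :: "complex set \<Rightarrow> (complex \<Rightarrow> complex) \<Rightarrow> ennreal" where
  "sup_norm \<sigma> f = (SUP z \<in> \<sigma>. ennreal (norm (f z)))"

definition BV_norm :: "complex set \<Rightarrow> (complex \<Rightarrow> complex) \<Rightarrow> ennreal" where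
  "BV_norm \<sigma> f = sup_norm \<sigma> f + var f \<sigma>"

definition BV :: "complex set \<Rightarrow> (complex \<Rightarrow> complex) set" where
  "BV \<sigma> = {f. BV_norm \<sigma> f < \<infinity>}"

definition variation_constant :: "complex set \<Rightarrow> ennreal" where
  "variation_constant \<sigma> = var (\<lambda>z. z) \<sigma>"

definition Lip_const :: "complex set \<Rightarrow> (complex \<Rightarrow> complex) \<Rightarrow> ennreal" where
  "Lip_const \<sigma> f =
     (SUP (x, x') \<in> {(x, x'). x \<in> \<sigma> \<and> x' \<in> \<sigma> \<and> x \<noteq> x'}.
        ennreal (norm (f x - f x') / norm (x - x')))"

definition Lip_norm :: "complex set \<Rightarrow> (complex \<Rightarrow> complex) \<Rightarrow> ennreal" where
  "Lip_norm \<sigma> f = sup_norm \<sigma> f + Lip_const \<sigma> f"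

definition Lip :: "complex set \<Rightarrow> (complex \<Rightarrow> complex) set" where
  "Lip \<sigma> = {f. Lip_norm \<sigma> f < \<infinity>}"

end

theory Submission
  imports Defs
begin

text \<open>A Lipschitz function with constant \<open>L\<close> satisfies \<open>cvar f S \<le> L * cvar \<zeta> S\<close>, which gives the
  inequality of norms. The inclusion also needs the variation constant to be finite: for a unit
  vector \<open>a\<close>, the projected variation \<open>\<Sum>\<bar>a \<bullet> (x\<^sub>j\<^sub>+\<^sub>1 - x\<^sub>j)\<bar>\<close> is the integral over \<open>t\<close> of the
  number of segments whose ends are strictly separated by the line \<open>a \<bullet> z = t\<close>. That number is at
  most \<open>vf S\<close>, and it vanishes unless \<open>t\<close> lies in the bounded projection of \<open>\<sigma>\<close>. Taking \<open>a = 1\<close>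
  and \<open>a = \<i>\<close> bounds \<open>cvar \<zeta> S / vf S\<close>.\<close>

lemma plane_line_hyperplane:
  assumes "a \<noteq> 0"
  shows "plane_line {z. a \<bullet> z = b}"
  using assms by (simp add: plane_line_def affine_hyperplane aff_dim_hyperplane)

lemma vf_on_le_length: "vf_on S l \<le> length S"
proof -
  have "card {j. Suc j < length S \<and> crossing_segment S l j} \<le> card {..<length S}"
    by (intro card_mono) auto
  then show ?thesis
    by (simp add: vf_on_def)
qed

lemma vf_on_le_vf:
  assumes "plane_line l"
  shows "vf_on S l \<le> vf S"
  unfolding vf_def
proof (rule Max_ge)
  have "{vf_on S l | l. plane_line l} \<subseteq> {..length S}"
    using vf_on_le_length by auto
  then show "finite {vf_on S l | l. plane_line l}"
    by (rule finite_subset) simp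
qed (use assms in auto)

text \<open>The \<open>min\<close>/\<open>max\<close> form treats both directions of travel at once,
  so the levels \<open>t\<close> that separate the two endpoints form an open interval.\<close>

lemma crossing_segment_hyperplane:
  assumes "a \<noteq> 0"
    and "min (a \<bullet> (S ! j)) (a \<bullet> (S ! Suc j)) < t" "t < max (a \<bullet> (S ! j)) (a \<bullet> (S ! Suc j))"
  shows "crossing_segment S {z. a \<bullet> z = t} j"
proof -
  \<comment> \<open>\<open>opposite_sides\<close> orients the equation of the line; a segment that
    descends through level \<open>t\<close> needs the negated equation.\<close>
  have neg: "{z. a \<bullet> z = t} = {z. (- a) \<bullet> z = - t}"
    by auto
  consider "a \<bullet> (S ! j) < t" "t < a \<bullet> (S ! Suc j)"
    | "(- a) \<bullet> (S ! j) < - t" "- t < (- a) \<bullet> (S ! Suc j)"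
    using assms(2,3) by (force simp: min_def max_def split: if_splits)
  then have "opposite_sides {z. a \<bullet> z = t} (S ! j) (S ! Suc j)"
  proof cases
    case 1
    then show ?thesis
      unfolding opposite_sides_def using assms(1) by blast
  next
    case 2
    then show ?thesis
      unfolding opposite_sides_def using assms(1) neg neg_equal_0_iff_equal by blast
  qed
  then show ?thesis
    by (simp add: crossing_segment_def)
qed

lemma cvar_eq: "cvar f S = (\<Sum>j | Suc j < length S. norm (f (S ! Suc j) - f (S ! j)))"
  unfolding cvar_def
  by (rule sum.reindex_bij_witness[where i = Suc and j = "\<lambda>i. i - 1"]) auto

lemma projected_variation_le:
  assumes "a \<noteq> 0" and "\<And>z. z \<in> set S \<Longrightarrow> lo \<le> a \<bullet> z \<and> a \<bullet> z \<le> hi" and "lo \<le> hi"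
  shows "(\<Sum>j | Suc j < length S. \<bar>a \<bullet> (S ! Suc j) - a \<bullet> (S ! j)\<bar>) \<le> (hi - lo) * real (vf S)"
proof -
  define J where "J = {j. Suc j < length S}"
  define p where "p j = a \<bullet> (S ! j)" for j
  \<comment> \<open>The levels strictly between the projected endpoints: an interval of length
    \<bar>p (Suc j) - p j\<bar>, left open so that each of its levels gives a crossing of type
    (1).\<close>
  define I where "I j = {min (p j) (p (Suc j))<..<max (p j) (p (Suc j))}" for j
  have finJ: "finite J"
    unfolding J_def by (rule finite_subset[of _ "{..<length S}"]) auto
  have range_I: "I j \<subseteq> {lo..hi}" if "j \<in> J" for j
    using assms(2)[of "S ! j"] assms(2)[of "S ! Suc j"] that
    by (auto simp: I_def J_def p_def)
  have int_I: "integrable lborel (indicat_real (I j))" for j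
    by (simp add: I_def integrable_indicator_iff)
  have count: "(\<Sum>j\<in>J. indicat_real (I j) t) \<le> real (vf S) * indicat_real {lo..hi} t" for t
  proof (cases "t \<in> {lo..hi}")
    case False
    then have "indicat_real (I j) t = 0" if "j \<in> J" for j
      using range_I[OF that] by (auto simp: indicator_def)
    then show ?thesis
      by simp
  next
    case True
    let ?l = "{z. a \<bullet> z = t}"
    have "(\<Sum>j\<in>J. indicat_real (I j) t) = real (card {j \<in> J. t \<in> I j})"
      using finJ by (simp add: indicator_def sum.If_cases Int_def)
    \<comment> \<open>One-point lists fall under the separate clause of \<open>vf_on\<close>; for
      them \<open>J\<close> is empty and the count is 0.\<close>
    also have "\<dots> \<le> real (vf_on S ?l)"
    proof (cases "length S = 1")
      case True
      then show ?thesis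
        by (simp add: J_def)
    next
      case False
      have "{j \<in> J. t \<in> I j} \<subseteq> {j. Suc j < length S \<and> crossing_segment S ?l j}"
        using crossing_segment_hyperplane[OF assms(1)] by (auto simp: J_def I_def p_def)
      moreover have "finite {j. Suc j < length S \<and> crossing_segment S ?l j}"
        using finJ by (simp add: J_def)
      ultimately show ?thesis
        using False by (simp add: vf_on_def card_mono)
    qed
    also have "\<dots> \<le> real (vf S)"
      using vf_on_le_vf[OF plane_line_hyperplane[OF assms(1)]] by simp
    finally show ?thesis
      using True by simp
  qed
  have "(\<Sum>j\<in>J. \<bar>p (Suc j) - p j\<bar>) = (\<Sum>j\<in>J. \<integral>t. indicat_real (I j) t \<partial>lborel)"
    by (intro sum.cong refl) (auto simp: I_def min_def max_def)
  also have "\<dots> = (\<integral>t. (\<Sum>j\<in>J. indicat_real (I j) t) \<partial>lborel)"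
    by (rule Bochner_Integration.integral_sum[symmetric]) (rule int_I)
  also have "\<dots> \<le> (\<integral>t. real (vf S) * indicat_real {lo..hi} t \<partial>lborel)"
    by (intro integral_mono count Bochner_Integration.integrable_sum int_I)
      (simp add: integrable_indicator_iff emeasure_lborel_Icc_eq)
  also have "\<dots> = (hi - lo) * real (vf S)"
    using assms(3) by simp
  finally show ?thesis
    by (simp add: J_def p_def)
qed

lemma variation_constant_finite:
  assumes "bounded \<sigma>"
  shows "variation_constant \<sigma> < \<infinity>"
proof -
  from assms obtain R where "R > 0" and R: "\<And>z. z \<in> \<sigma> \<Longrightarrow> norm z \<le> R"
    by (auto simp: bounded_pos)
  \<comment> \<open>The constant is \<open>2 * R\<close>, the length of [-R, R], once for each of
    the two coordinate projections.\<close>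
  have "cvar (\<lambda>z. z) S / real (vf S) \<le> 4 * R" if "set S \<subseteq> \<sigma>" for S
  proof -
    have proj: "(\<Sum>j | Suc j < length S. \<bar>a \<bullet> (S ! Suc j) - a \<bullet> (S ! j)\<bar>) \<le> 2 * R * real (vf S)"
      if "norm a = 1" for a
    proof -
      have "- R \<le> a \<bullet> z \<and> a \<bullet> z \<le> R" if "z \<in> set S" for z
        using Cauchy_Schwarz_ineq2[of a z] R[of z] \<open>norm a = 1\<close> \<open>set S \<subseteq> \<sigma>\<close> that
        by (auto simp: abs_le_iff)
      then show ?thesis
        using projected_variation_le[of a S "- R" R] that \<open>R > 0\<close> by force
    qed
    \<comment> \<open>Inner products with \<open>1\<close> and \<open>\<i>\<close> are the real and
      imaginary parts, whose absolute values sum to at least the modulus.\<close>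
    have "cvar (\<lambda>z. z) S \<le> (\<Sum>j | Suc j < length S.
        \<bar>1 \<bullet> (S ! Suc j) - 1 \<bullet> (S ! j)\<bar> + \<bar>\<i> \<bullet> (S ! Suc j) - \<i> \<bullet> (S ! j)\<bar>)"
      unfolding cvar_eq
    proof (rule sum_mono)
      fix j
      show "norm (S ! Suc j - S ! j)
          \<le> \<bar>1 \<bullet> (S ! Suc j) - 1 \<bullet> (S ! j)\<bar> + \<bar>\<i> \<bullet> (S ! Suc j) - \<i> \<bullet> (S ! j)\<bar>"
        using cmod_le[of "S ! Suc j - S ! j"] by (simp add: inner_complex_def)
    qed
    also have "\<dots> \<le> 4 * R * real (vf S)"
      using proj[of 1] proj[of \<i>] by (simp add: sum.distrib)
    finally show ?thesis
      \<comment> \<open>Division by zero yields 0, which settles the case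
        \<open>vf S = 0\<close>.\<close>
      using \<open>R > 0\<close> by (cases "vf S = 0") (simp_all add: divide_le_eq)
  qed
  then have "variation_constant \<sigma> \<le> ennreal (4 * R)"
    unfolding variation_constant_def var_def by (intro SUP_least ennreal_leI) auto
  then show ?thesis
    using ennreal_less_top le_less_trans by (metis infinity_ennreal_def)
qed

text \<open>Finiteness matters because \<open>enn2real\<close> sends infinity to 0. The supremum
  ranges over distinct points, so \<open>x = y\<close> is a separate case.\<close>

lemma norm_diff_le_Lip_const:
  assumes "Lip_const \<sigma> f < \<infinity>" and "x \<in> \<sigma>" "y \<in> \<sigma>"
  shows "norm (f x - f y) \<le> enn2real (Lip_const \<sigma> f) * norm (x - y)"
proof (cases "x = y")
  case False
  have "ennreal (norm (f x - f y) / norm (x - y)) \<le> Lip_const \<sigma> f"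
    unfolding Lip_const_def by (rule SUP_upper2[of "(x, y)"]) (use assms False in auto)
  also have "Lip_const \<sigma> f = ennreal (enn2real (Lip_const \<sigma> f))"
    using assms(1) by simp
  finally show ?thesis
    using False by (simp add: divide_le_eq)
qed simp

text \<open>The comparison is made list by list: each increment of \<open>f\<close> is at most the
  Lipschitz constant times that of the identity, and both sums are divided by the same
  \<open>vf S\<close>.\<close>

lemma var_le_Lip_const:
  assumes "Lip_const \<sigma> f < \<infinity>"
  shows "var f \<sigma> \<le> Lip_const \<sigma> f * variation_constant \<sigma>"
  unfolding var_def
proof (rule SUP_least)
  fix S assume S: "S \<in> {S. S \<noteq> [] \<and> set S \<subseteq> \<sigma>}"
  define L where "L = enn2real (Lip_const \<sigma> f)"
  have "L \<ge> 0" and L: "ennreal L = Lip_const \<sigma> f"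
    using assms by (simp_all add: L_def)
  have "cvar f S \<le> (\<Sum>j | Suc j < length S. L * norm (S ! Suc j - S ! j))"
    unfolding cvar_eq
    by (rule sum_mono) (use S norm_diff_le_Lip_const[OF assms] in \<open>auto simp: L_def subset_iff\<close>)
  also have "\<dots> = L * cvar (\<lambda>z. z) S"
    by (simp add: cvar_eq sum_distrib_left)
  finally have "cvar f S / real (vf S) \<le> L * (cvar (\<lambda>z. z) S / real (vf S))"
    by (simp add: divide_right_mono)
  then have "ennreal (cvar f S / real (vf S)) \<le> ennreal L * ennreal (cvar (\<lambda>z. z) S / real (vf S))"
    using \<open>L \<ge> 0\<close> by (simp add: ennreal_mult'[symmetric] ennreal_leI)
  also have "\<dots> \<le> Lip_const \<sigma> f * variation_constant \<sigma>"
    unfolding L variation_constant_def var_def by (intro mult_left_mono SUP_upper S) simp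
  finally show "ennreal (cvar f S / real (vf S)) \<le> Lip_const \<sigma> f * variation_constant \<sigma>" .
qed

text \<open>The two summands are bounded separately: the sup norm takes the factor 1, the variation
  takes the factor \<open>variation_constant \<sigma>\<close>, and the maximum dominates
  both.\<close>

lemma BV_norm_le_Lip_norm:
  assumes "f \<in> Lip \<sigma>"
  shows "BV_norm \<sigma> f \<le> max 1 (variation_constant \<sigma>) * Lip_norm \<sigma> f"
proof -
  let ?M = "max 1 (variation_constant \<sigma>)"
  have "Lip_const \<sigma> f < \<infinity>"
    using assms by (simp add: Lip_def Lip_norm_def)
  then have "var f \<sigma> \<le> Lip_const \<sigma> f * variation_constant \<sigma>"
    by (rule var_le_Lip_const)
  also have "\<dots> \<le> Lip_const \<sigma> f * ?M"
    by (intro mult_left_mono) auto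
  finally have "var f \<sigma> \<le> ?M * Lip_const \<sigma> f"
    by (simp add: mult.commute)
  moreover have "1 * sup_norm \<sigma> f \<le> ?M * sup_norm \<sigma> f"
    by (intro mult_right_mono) auto
  ultimately show ?thesis
    by (simp add: BV_norm_def Lip_norm_def distrib_left add_mono)
qed

theorem theorem3p11:
  fixes \<sigma> :: "complex set"
  assumes "compact \<sigma>" and "\<sigma> \<noteq> {}"
  shows "(\<forall>f \<in> Lip \<sigma>. BV_norm \<sigma> f \<le> max 1 (variation_constant \<sigma>) * Lip_norm \<sigma> f) \<and> Lip \<sigma> \<subseteq> BV \<sigma>"
proof (intro conjI ballI subsetI)
  fix f assume f: "f \<in> Lip \<sigma>"
  then show le: "BV_norm \<sigma> f \<le> max 1 (variation_constant \<sigma>) * Lip_norm \<sigma> f"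
    by (rule BV_norm_le_Lip_norm)
  \<comment> \<open>Compactness gives boundedness and hence a finite variation constant, so both
    factors are finite.\<close>
  have "max 1 (variation_constant \<sigma>) * Lip_norm \<sigma> f < \<infinity>"
    using variation_constant_finite[OF compact_imp_bounded[OF assms(1)]] f
    by (auto simp: Lip_def ennreal_mult_less_top max_def)
  with le show "f \<in> BV \<sigma>"
    by (simp add: BV_def)
qed

end
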